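(* Every zero-closed semigroup $X$ has polyboundedness number $\mathrm{cov}(\mathcal A_X)<\max\{2,|X|\}$.
   Context: For a semigroup $X$, the $0$-extension of $X$ is the semigroup $X^0=X\cup\{0\}$, where $0\notin X$ is a new element with $0x=0=x0$ for every $x\in X^0$; the $1$-extension of $X$ is the semigroup $X^1=X\cup\{1\}$, where $1\notin X$ is a new element with $1x=x=x1$ for every $x\in X^1$. A topology on a semigroup $S$ is a semigroup topology if the binary operation $S\times S\to S$ is continuous. A semigroup $X$ (carrying no topology) is zero-closed if $X$ is a closed subset of $X^0$ for every Hausdorff semigroup topology on $X^0$. A subset $A$ of a semigroup $X$ is algebraic if $A=\{x\in X: a_0xa_1x\cdots xa_n=b\}$ for some integer $n\ge 1$, some $b\in X$ and some $a_0,\dots,a_n\in X^1$. $\mathcal A_X$ denotes the family of all algebraic subsets of $X$, and the polyboundedness number $\mathrm{cov}(\mathcal A_X)$ is the smallest cardinality of a subfamily $\mathcal C\subseteq\mathcal A_X$ with $X=\bigcup\mathcal C$. *)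

theory Defs
  imports "HOL-Analysis.T1_Spaces"
begin

unbundle cardinal_syntax

datatype 'a zero_ext = Zero | ZElem 'a

instantiation zero_ext :: (semigroup_mult) "{semigroup_mult, mult_zero}"
begin

definition zero_zero_ext :: "'a zero_ext"
  where "0 = Zero"

fun times_zero_ext :: "'a zero_ext \<Rightarrow> 'a zero_ext \<Rightarrow> 'a zero_ext"
  where
    "ZElem x * ZElem y = ZElem (x * y)"
  | "Zero * _ = Zero"
  | "_ * Zero = Zero"

instance
proof
  fix x y z :: "'a zero_ext"
  show "x * y * z = x * (y * z)"
    by (cases x; cases y; cases z) (simp_all add: mult.assoc)
  show "0 * x = 0" "x * 0 = 0"
    by (cases x; simp add: zero_zero_ext_def)+
qed

end

datatype 'a one_ext = One | OElem 'a

instantiation one_ext :: (semigroup_mult) monoid_mult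
begin

definition one_one_ext :: "'a one_ext"
  where "1 = One"

fun times_one_ext :: "'a one_ext \<Rightarrow> 'a one_ext \<Rightarrow> 'a one_ext"
  where
    "OElem x * OElem y = OElem (x * y)"
  | "One * y = y"
  | "x * One = x"

instance
proof
  fix x y z :: "'a one_ext"
  show "x * y * z = x * (y * z)"
    by (cases x; cases y; cases z) (simp_all add: mult.assoc)
  show "1 * x = x" "x * 1 = x"
    by (cases x; simp add: one_one_ext_def)+
qed

end

definition semigroup_topology :: "'a::semigroup_mult topology \<Rightarrow> bool"
  where "semigroup_topology T \<longleftrightarrow>
    topspace T = UNIV \<and> continuous_map (prod_topology T T) T (\<lambda>(x, y). x * y)"

text \<open>The argument only carries the type of the semigroup.\<close>

definition zero_closed :: "'a::semigroup_mult itself \<Rightarrow> bool"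
  where "zero_closed (_ :: 'a itself) \<longleftrightarrow>
    (\<forall>T :: 'a zero_ext topology.
      semigroup_topology T \<longrightarrow> Hausdorff_space T \<longrightarrow> closedin T (range ZElem))"

definition algebraic_set :: "'a::semigroup_mult set \<Rightarrow> bool"
  where "algebraic_set A \<longleftrightarrow>
    (\<exists>n\<ge>1. \<exists>(a :: nat \<Rightarrow> 'a one_ext) b.
      A = {x. a 0 * prod_list (map (\<lambda>i. OElem x * a i) [1..<Suc n]) = OElem b})"

definition covering_number :: "'a set set \<Rightarrow> 'a set rel"
  where "covering_number F =
    (SOME \<kappa>. \<kappa> \<in> {|C| |C. C \<subseteq> F \<and> \<Union>C = UNIV} \<and>
            (\<forall>\<mu>\<in>{|C| |C. C \<subseteq> F \<and> \<Union>C = UNIV}. \<kappa> \<le>o \<mu>))"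

definition polyboundedness_number :: "'a::semigroup_mult itself \<Rightarrow> 'a set rel"
  where "polyboundedness_number (_ :: 'a itself) = covering_number {A :: 'a set. algebraic_set A}"

text \<open>The maximum of two cardinals living on different types, transferred to the sum type.\<close>

definition card_max :: "'a rel \<Rightarrow> 'b rel \<Rightarrow> ('a + 'b) rel"
  where "card_max r s = (if r \<le>o s then |Inr ` Field s| else |Inl ` Field r| )"

lemma algebraic_set_singleton: "algebraic_set {b}"
proof -
  have "{b} = {x. (1 :: 'a one_ext) * prod_list (map (\<lambda>i. OElem x * 1) [1..<Suc 1]) = OElem b}"
    by auto
  then show ?thesis
    unfolding algebraic_set_def
    by (intro exI[of _ "1 :: nat"] conjI exI[of _ "\<lambda>_. 1"] exI[of _ b]) simp_all
qed

text \<open>The choice in \<^const>\<open>covering_number\<close> is well defined as soon as the family covers;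
  by the preceding lemma the algebraic sets do.\<close>

lemma covering_number_least:
  assumes "\<Union>F = UNIV"
  shows "\<exists>C\<subseteq>F. \<Union>C = UNIV \<and> covering_number F = |C|"
    and "C \<subseteq> F \<Longrightarrow> \<Union>C = UNIV \<Longrightarrow> covering_number F \<le>o |C|"
proof -
  let ?R = "{|C| |C. C \<subseteq> F \<and> \<Union>C = UNIV}"
  have "\<exists>\<kappa>\<in>?R. \<forall>\<mu>\<in>?R. \<kappa> \<le>o \<mu>"
    using assms by (intro exists_minim_Card_order) (auto simp: card_of_Card_order)
  then have *: "covering_number F \<in> ?R \<and> (\<forall>\<mu>\<in>?R. covering_number F \<le>o \<mu>)"
    unfolding covering_number_def Bex_def by (rule someI_ex)
  from conjunct1[OF *] show "\<exists>C\<subseteq>F. \<Union>C = UNIV \<and> covering_number F = |C|"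
    by auto
  show "covering_number F \<le>o |C|" if "C \<subseteq> F" "\<Union>C = UNIV"
    by (rule bspec[OF conjunct2[OF *]]) (use that in auto)
qed

lemma card_max_ordIso:
  assumes "Card_order r" "Card_order s"
  shows "r \<le>o s \<Longrightarrow> card_max r s =o s" and "s \<le>o r \<Longrightarrow> card_max r s =o r"
proof -
  have s: "|Inr ` Field s :: ('a + 'b) set| =o s" if "Card_order s" for s :: "'b rel"
  proof -
    have "|Field s| =o |Inr ` Field s :: ('a + 'b) set|"
      by (rule card_of_ordIsoI[of Inr]) (simp add: bij_betw_def)
    then show ?thesis
      using card_of_Field_ordIso[OF that] ordIso_symmetric ordIso_transitive by blast
  qed
  have r: "|Inl ` Field r :: ('a + 'b) set| =o r" if "Card_order r" for r :: "'a rel"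
  proof -
    have "|Field r| =o |Inl ` Field r :: ('a + 'b) set|"
      by (rule card_of_ordIsoI[of Inl]) (simp add: bij_betw_def)
    then show ?thesis
      using card_of_Field_ordIso[OF that] ordIso_symmetric ordIso_transitive by blast
  qed
  show *: "card_max r s =o s" if "r \<le>o s"
    using s[OF assms(2)] that by (simp add: card_max_def)
  show "card_max r s =o r" if "s \<le>o r"
  proof (cases "r \<le>o s")
    case True
    then have "s =o r"
      using that by (simp add: ordIso_iff_ordLeq)
    then show ?thesis
      using *[OF True] ordIso_transitive by blast
  next
    case False
    then show ?thesis
      using r[OF assms(1)] by (simp add: card_max_def)
  qed
qed

end

theory Submission
  imports Defs
begin

text \<open>Write \<open>\<kappa>\<close> for the cardinality of the semigroup \<open>X\<close>. Two different reasons are at work.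

  If \<open>X\<close> is finite, then a single algebraic set covers it. For a minimal idempotent \<open>e\<close> every
  element \<open>e x e\<close> has a power equal to \<open>e\<close>, so some common exponent \<open>N\<close> turns \<open>(e x e)^N\<close> into a
  constant polynomial (\<open>finite_semigroup_constant_word\<close>); hence the covering number is at most \<open>1\<close>.

  If \<open>X\<close> is infinite and is not a union of fewer than \<open>\<kappa>\<close> algebraic sets, then there is a
  Hausdorff semigroup topology on \<open>X \<union> {0}\<close> in which the points of \<open>X\<close> are isolated and \<open>0\<close> is not,
  so that \<open>X\<close> is not closed. Well-order \<open>X\<close> in type \<open>\<kappa>\<close> and choose elements \<open>x \<gamma>\<close> by transfinite
  recursion. At stage \<open>\<gamma>\<close> let \<open>X \<gamma>\<close> consist of the points below \<open>\<gamma>\<close> and of all values of polynomials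
  produced at earlier stages. This set has fewer than \<open>\<kappa>\<close> elements, so there are fewer than \<open>\<kappa>\<close>
  equations \<open>p(x) = b\<close> with \<open>p\<close> a nonconstant polynomial over \<open>X \<gamma>\<close> and \<open>b \<in> X \<gamma>\<close>; their solution
  sets are algebraic and therefore do not cover \<open>X\<close>, and \<open>x \<gamma>\<close> is taken outside all of them
  (\<open>generic_element\<close>, \<open>generic_family\<close>). The neighbourhoods of \<open>0\<close> are the sets of all \<open>p(x \<gamma>)\<close>
  with \<open>\<gamma> > \<beta>\<close> and \<open>p\<close> as above. They shrink to \<open>0\<close> because \<open>p(x \<gamma>)\<close> avoids everything below \<open>\<gamma>\<close>.
  Multiplication is continuous because for \<open>\<gamma> < \<delta>\<close> the value \<open>p(x \<gamma>)\<close> lies in \<open>X \<delta>\<close>, so that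
  \<open>p(x \<gamma>) q(x \<delta>)\<close> is again a polynomial over \<open>X \<delta>\<close> evaluated at \<open>x \<delta>\<close>.

  One point needs care: at a stage \<open>\<gamma>\<close> with only finitely many predecessors \<open>X \<gamma>\<close> must stay finite,
  or the choice of \<open>x \<gamma>\<close> would break down for countable \<open>X\<close>. There the words representing \<open>p\<close> are
  restricted to length at most \<open>2^n\<close>, where \<open>n\<close> is the number of predecessors. Products double the
  length, so the neighbourhoods carry a second index \<open>j\<close>, lowering the bound to \<open>2^(n - j)\<close>.\<close>

section \<open>Words and algebraic sets\<close>

text \<open>A polynomial over the semigroup, as the list of its letters: \<open>None\<close> stands for the variable and
  \<open>Some c\<close> for the coefficient \<open>c\<close>. Lists make products of polynomials and counting them easy,
  unlike the alternating form in the definition of algebraic sets.\<close>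

definition eval_word :: "'a::semigroup_mult option list \<Rightarrow> 'a \<Rightarrow> 'a one_ext"
  where "eval_word w x = prod_list (map (case_option (OElem x) OElem) w)"

lemma eval_word_simps [simp]:
  "eval_word [] x = 1"
  "eval_word (None # w) x = OElem x * eval_word w x"
  "eval_word (Some c # w) x = OElem c * eval_word w x"
  "eval_word (v @ w) x = eval_word v x * eval_word w x"
  by (simp_all add: eval_word_def)

text \<open>Adjacent coefficients are multiplied together and a missing coefficient becomes the adjoined
  unit, which gives the alternating form of a polynomial.\<close>

lemma eval_word_normal_form:
  "\<exists>n a. (None \<in> set w \<longrightarrow> n \<ge> 1) \<and>
     (\<forall>x. eval_word w x = a 0 * prod_list (map (\<lambda>i. OElem x * a i) [1..<Suc n]))"
proof (induction w)
  case Nil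
  show ?case
    by (intro exI[of _ 0] exI[of _ "\<lambda>_. 1"]) simp
next
  case (Cons c w)
  then obtain n a where n: "None \<in> set w \<longrightarrow> n \<ge> 1"
    and a: "\<And>x. eval_word w x = a 0 * prod_list (map (\<lambda>i. OElem x * a i) [1..<Suc n])"
    by blast
  show ?case
  proof (cases c)
    case None
    have shift: "[1..<Suc (Suc n)] = 1 # map Suc [1..<Suc n]"
      using upt_conv_Cons[of 1 "Suc (Suc n)"] map_Suc_upt[of 1 "Suc n"] by simp
    show ?thesis
      by (intro exI[of _ "Suc n"] exI[of _ "\<lambda>i. if i = 0 then 1 else a (i - 1)"] conjI allI)
        (simp, simp only: None eval_word_simps a shift, simp add: mult.assoc comp_def del: upt_Suc)
  next
    case (Some d)
    have tail: "map (\<lambda>i. OElem x * (if i = 0 then b else a i)) [1..<Suc n] =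
        map (\<lambda>i. OElem x * a i) [1..<Suc n]" for x b
      by (rule map_cong) auto
    show ?thesis
      using n by (intro exI[of _ n] exI[of _ "\<lambda>i. if i = 0 then OElem d * a 0 else a i"] conjI allI)
        (simp add: Some, simp only: Some eval_word_simps a tail, simp add: mult.assoc del: upt_Suc)
  qed
qed

lemma algebraic_set_word:
  assumes "None \<in> set w"
  shows "algebraic_set {x. eval_word w x = OElem b}"
proof -
  obtain n a where "n \<ge> 1"
    and "\<And>x. eval_word w x = a 0 * prod_list (map (\<lambda>i. OElem x * a i) [1..<Suc n])"
    using eval_word_normal_form[of w] assms by blast
  then show ?thesis
    unfolding algebraic_set_def by (intro exI[of _ n] conjI exI[of _ a] exI[of _ b]) simp_all
qed

lemma eval_word_in_semigroup:
  assumes "w \<noteq> []"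
  shows "\<exists>y. eval_word w x = OElem y"
  using assms
proof (induction w)
  case (Cons c w)
  have "\<exists>y. OElem d * z = OElem y" for d :: 'a and z
    by (cases z) auto
  then show ?case
    by (cases c) auto
qed simp

section \<open>Finite semigroups\<close>

text \<open>Among the powers of \<open>y\<close> two coincide, so the sequence of powers is periodic with some period \<open>d\<close>
  from some exponent \<open>m\<close> on; then \<open>y^(m * d)\<close> is idempotent. Powers are taken in the monoid
  obtained by adjoining a unit.\<close>

lemma finite_semigroup_idempotent_power:
  fixes y :: "'a::semigroup_mult"
  assumes "finite (UNIV :: 'a set)"
  shows "\<exists>n\<ge>1. \<exists>f. OElem y ^ n = OElem f \<and> f * f = f"
proof -
  have in_X: "\<exists>f. OElem y ^ n = OElem f" if n: "n \<ge> 1" for n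
    using eval_word_in_semigroup[of "replicate n None" y] n
    by (simp add: eval_word_def prod_list_replicate)
  define p where "p n = OElem y ^ Suc n" for n
  have "range p \<subseteq> range OElem"
    using in_X by (auto simp: p_def simp del: power_Suc)
  then have "finite (range p)"
    using assms finite_subset by blast
  then obtain i j where "i < j" "p i = p j"
    using linorder_injI[of p] infinite_UNIV_nat finite_imageD by metis
  define m d where "m = Suc i" and "d = j - i"
  have m: "m \<ge> 1" and d: "d \<ge> 1" and eq: "OElem y ^ (m + d) = OElem y ^ m"
    using \<open>i < j\<close> \<open>p i = p j\<close> by (auto simp: m_def d_def p_def simp del: power_Suc)
  have period: "OElem y ^ (m + k * d) = OElem y ^ m" for k
  proof (induction k)
    case (Suc k)
    have "OElem y ^ (m + Suc k * d) = OElem y ^ (m + k * d) * OElem y ^ d"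
      by (simp add: power_add[symmetric] algebra_simps)
    also have "\<dots> = OElem y ^ m"
      using Suc eq by (simp add: power_add)
    finally show ?case .
  qed simp
  obtain k where k: "d = Suc k"
    using d by (cases d) auto
  have "OElem y ^ (m * d) * OElem y ^ (m * d) = OElem y ^ (m * k) * OElem y ^ (m + m * d)"
    unfolding power_add[symmetric] by (simp add: k algebra_simps)
  also have "\<dots> = OElem y ^ (m * k) * OElem y ^ m"
    by (simp add: period)
  also have "\<dots> = OElem y ^ (m * d)"
    unfolding power_add[symmetric] by (simp add: k algebra_simps)
  finally have idem: "OElem y ^ (m * d) * OElem y ^ (m * d) = OElem y ^ (m * d)" .
  have "m * d \<ge> 1"
    using m d by (simp add: Suc_le_eq)
  with in_X[OF this] idem show ?thesis
    by (metis one_ext.inject times_one_ext.simps(1))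
qed

text \<open>If \<open>e\<close> is a minimal idempotent, then \<open>e\<close> is the only idempotent of the monoid \<open>e X e\<close>. So each
  \<open>e x e\<close> has a power equal to \<open>e\<close>, and the product \<open>N\<close> of the finitely many exponents works for
  all \<open>x\<close> at once.\<close>

lemma finite_semigroup_constant_word:
  assumes fin: "finite (UNIV :: 'a::semigroup_mult set)"
  shows "\<exists>w e. None \<in> set w \<and> (\<forall>x::'a. eval_word w x = OElem e)"
proof -
  define M where "M e = {e * x * e |x. True}" for e :: 'a
  obtain f0 :: 'a where "f0 * f0 = f0"
    using finite_semigroup_idempotent_power[OF fin] by metis
  \<comment> \<open>The idempotents are ordered by \<open>f \<le> e \<longleftrightarrow> f \<in> e X e\<close>, and the size of \<open>e X e\<close> is strictly
    monotone for this order, so its least value is attained at a minimal idempotent.\<close>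
  then obtain e where e: "e * e = e" and min: "\<And>f. f * f = f \<Longrightarrow> card (M e) \<le> card (M f)"
    using ex_has_least_nat[of "\<lambda>e. e * e = e" f0 "\<lambda>e. card (M e)"] by metis
  have minimal: "f = e" if f: "f * f = f" and fM: "f \<in> M e" for f
  proof -
    have ef: "e * f = f" and fe: "f * e = f"
      using fM e by (auto simp: M_def) (metis mult.assoc)+
    have "M f \<subseteq> M e"
    proof
      fix y assume "y \<in> M f"
      then obtain x where "y = f * x * f"
        by (auto simp: M_def)
      then have "y = e * y * e"
        using ef fe by (metis mult.assoc)
      then show "y \<in> M e"
        by (auto simp: M_def)
    qed
    then have "M f = M e"
      using min[OF f] fin by (metis card_seteq finite_subset subset_UNIV)
    moreover have "e \<in> M e"
      using e by (auto simp: M_def intro!: exI[of _ e])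
    ultimately have "e \<in> M f"
      by simp
    then have "e * f = e"
      using f by (auto simp: M_def) (metis mult.assoc)
    then show ?thesis
      using ef by simp
  qed
  have absorb: "v * u ^ n = u ^ n \<and> u ^ n * v = u ^ n" if "v * u = u" "u * v = u" "n \<ge> 1"
    for u v :: "'a one_ext" and n :: nat
    using that by (cases n) (simp, metis mult.assoc power_Suc power_Suc2)
  have "\<exists>n\<ge>1. OElem (e * x * e) ^ n = OElem e" for x
  proof -
    obtain n f where n: "n \<ge> 1" "OElem (e * x * e) ^ n = OElem f" "f * f = f"
      using finite_semigroup_idempotent_power[OF fin] by metis
    have "OElem e * OElem (e * x * e) = OElem (e * x * e)"
      "OElem (e * x * e) * OElem e = OElem (e * x * e)"
      using e by (simp_all, metis mult.assoc, metis mult.assoc)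
    from absorb[OF this n(1)]
    have "e * f * e = f"
      by (simp add: n(2))
    then have "f \<in> M e"
      by (auto simp: M_def intro!: exI[of _ f])
    with n minimal show ?thesis
      by blast
  qed
  then obtain n where n: "\<And>x. n x \<ge> 1" "\<And>x. OElem (e * x * e) ^ n x = OElem e"
    by metis
  define N where "N = prod n UNIV"
  have N: "OElem (e * x * e) ^ N = OElem e" for x
  proof -
    have "N = n x * prod n (UNIV - {x})"
      unfolding N_def using fin by (simp add: prod.remove)
    moreover have "OElem e ^ k = OElem e" if "k \<ge> 1" for k
      using that by (induction k rule: dec_induct) (simp_all add: e)
    moreover have "prod n (UNIV - {x}) \<ge> 1"
      using n(1) by (simp add: Suc_le_eq prod_pos)
    ultimately show ?thesis
      by (simp add: power_mult n(2))
  qed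
  have "N \<ge> 1"
    using n(1) by (simp add: N_def Suc_le_eq prod_pos)
  define w where "w = concat (replicate N [Some e, None, Some e])"
  have "eval_word w x = OElem (e * x * e) ^ N" for x
    unfolding w_def by (induction N) (simp_all add: mult.assoc[symmetric])
  moreover have "None \<in> set w"
    using \<open>N \<ge> 1\<close> by (simp add: w_def)
  ultimately show ?thesis
    using N by metis
qed

section \<open>A topology making zero a limit point\<close>

text \<open>The sets \<open>V i \<union> {0}\<close> serve as a base of neighbourhoods of \<open>0\<close>, and all other points are isolated.
  The hypotheses are what this topology needs to be a topology (\<open>directed\<close>), to make
  multiplication continuous at \<open>(0, 0)\<close> (\<open>mult\<close>) and at \<open>(a, 0)\<close> and \<open>(0, a)\<close> (\<open>shift\<close>), to be
  Hausdorff (\<open>separated\<close>), and to have \<open>0\<close> in the closure of the semigroup (\<open>nonempty\<close>).\<close>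

lemma not_zero_closedI:
  fixes V :: "'i \<Rightarrow> 'a::semigroup_mult set"
  assumes nonempty: "\<And>i. V i \<noteq> {}"
    and directed: "\<And>i j. \<exists>k. V k \<subseteq> V i \<inter> V j"
    and mult: "\<And>i. \<exists>j. \<forall>x\<in>V j. \<forall>y\<in>V j. x * y \<in> V i"
    and shift: "\<And>i a. \<exists>j. \<forall>x\<in>V j. a * x \<in> V i \<and> x * a \<in> V i"
    and separated: "\<And>b. \<exists>i. b \<notin> V i"
  shows "\<not> zero_closed TYPE('a)"
proof
  assume zc: "zero_closed TYPE('a)"
  define N where "N i = insert Zero (ZElem ` V i)" for i
  define opn where "opn U \<longleftrightarrow> (Zero \<in> U \<longrightarrow> (\<exists>i. N i \<subseteq> U))" for U
  have "istopology opn"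
    unfolding istopology_def
  proof (intro conjI allI impI)
    fix S T assume "opn S" "opn T"
    show "opn (S \<inter> T)"
      unfolding opn_def
    proof
      assume "Zero \<in> S \<inter> T"
      then obtain i j where "N i \<subseteq> S" "N j \<subseteq> T"
        using \<open>opn S\<close> \<open>opn T\<close> by (auto simp: opn_def)
      moreover obtain k where "V k \<subseteq> V i \<inter> V j"
        using directed by blast
      ultimately show "\<exists>k. N k \<subseteq> S \<inter> T"
        unfolding N_def by (intro exI[of _ k]) blast
    qed
  next
    fix K assume "\<forall>S\<in>K. opn S"
    then show "opn (\<Union>K)"
      unfolding opn_def by (meson UnionE Union_upper order_trans)
  qed
  define T where "T = topology opn"
  have openin_T: "openin T U \<longleftrightarrow> opn U" for U
    using \<open>istopology opn\<close> by (simp add: T_def)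
  have "openin T UNIV"
    using openin_T by (simp add: opn_def)
  then have space: "topspace T = UNIV"
    using openin_subset by blast
  have N_open: "openin T (N i)" for i
    by (auto simp: openin_T opn_def)
  have point_open: "openin T {ZElem x}" for x
    by (simp add: openin_T opn_def)
  have "semigroup_topology T"
    unfolding semigroup_topology_def
  proof
    show "continuous_map (prod_topology T T) T (\<lambda>(x, y). x * y)"
      unfolding continuous_map_def
    proof (intro conjI allI impI)
      show "(\<lambda>(x, y). x * y) \<in> topspace (prod_topology T T) \<rightarrow> topspace T"
        by (simp add: space)
      fix U assume U: "openin T U"
      have "\<exists>A B. openin T A \<and> openin T B \<and> u \<in> A \<and> v \<in> B \<and> (\<forall>a\<in>A. \<forall>b\<in>B. a * b \<in> U)"
        if uv: "u * v \<in> U" for u v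
      proof (cases u; cases v)
        fix a b assume "u = ZElem a" "v = ZElem b"
        then show ?thesis
          using uv point_open by (intro exI[of _ "{u}"] exI[of _ "{v}"]) auto
      next
        fix a assume u: "u = ZElem a" and v: "v = Zero"
        then obtain i where "N i \<subseteq> U"
          using uv U by (auto simp: openin_T opn_def)
        moreover obtain j where "\<forall>x\<in>V j. a * x \<in> V i \<and> x * a \<in> V i"
          using shift by blast
        ultimately show ?thesis
          using u v point_open N_open
          by (intro exI[of _ "{u}"] exI[of _ "N j"]) (auto simp: N_def)
      next
        fix b assume u: "u = Zero" and v: "v = ZElem b"
        then obtain i where "N i \<subseteq> U"
          using uv U by (auto simp: openin_T opn_def)
        moreover obtain j where "\<forall>x\<in>V j. b * x \<in> V i \<and> x * b \<in> V i"
          using shift by blast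
        ultimately show ?thesis
          using u v point_open N_open
          by (intro exI[of _ "N j"] exI[of _ "{v}"]) (auto simp: N_def)
      next
        assume u: "u = Zero" and v: "v = Zero"
        then obtain i where "N i \<subseteq> U"
          using uv U by (auto simp: openin_T opn_def)
        moreover obtain j where "\<forall>x\<in>V j. \<forall>y\<in>V j. x * y \<in> V i"
          using mult by blast
        ultimately show ?thesis
          using u v N_open
          by (intro exI[of _ "N j"] exI[of _ "N j"]) (auto simp: N_def)
      qed
      then show "openin (prod_topology T T)
          {p \<in> topspace (prod_topology T T). (case p of (x, y) \<Rightarrow> x * y) \<in> U}"
        unfolding openin_prod_topology_alt by (fastforce simp: space)
    qed
  qed (fact space)
  moreover have "Hausdorff_space T"
    unfolding Hausdorff_space_def
  proof (intro allI impI)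
    have zero: "\<exists>U V. openin T U \<and> openin T V \<and> ZElem b \<in> U \<and> Zero \<in> V \<and> disjnt U V" for b
    proof -
      obtain i where "b \<notin> V i"
        using separated by blast
      then show ?thesis
        using point_open N_open
        by (intro exI[of _ "{ZElem b}"] exI[of _ "N i"]) (auto simp: N_def)
    qed
    fix u v assume uv: "u \<in> topspace T \<and> v \<in> topspace T \<and> u \<noteq> v"
    show "\<exists>U V. openin T U \<and> openin T V \<and> u \<in> U \<and> v \<in> V \<and> disjnt U V"
    proof (cases u; cases v)
      fix a b assume "u = ZElem a" "v = ZElem b"
      then show ?thesis
        using uv point_open by (intro exI[of _ "{u}"] exI[of _ "{v}"]) auto
    qed (use uv zero in \<open>auto; metis disjnt_sym\<close>)+
  qed
  ultimately have "closedin T (range ZElem)"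
    using zc unfolding zero_closed_def by blast
  moreover have "UNIV - range ZElem = {Zero :: 'a zero_ext}"
    by (auto, metis rangeI zero_ext.exhaust)
  ultimately have "openin T {Zero}"
    by (simp add: closedin_def space)
  then obtain i where "N i \<subseteq> {Zero}"
    by (auto simp: openin_T opn_def)
  then show False
    using nonempty[of i] by (auto simp: N_def)
qed

section \<open>Cardinality of the stages\<close>

lemma finite_ordLess_infinite_set:
  assumes "finite A" "infinite B"
  shows "|A| <o |B|"
  by (rule finite_ordLess_infinite[OF card_of_Well_order card_of_Well_order])
    (simp_all add: assms Field_card_of)

lemma card_of_lists_ordLeq_infinite:
  assumes C: "infinite C" and BC: "|B| \<le>o |C|"
  shows "|lists B| \<le>o |C|"
proof -
  have len: "|{l \<in> lists B. length l = n}| \<le>o |C|" for n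
  proof (induction n)
    case 0
    have "{l \<in> lists B. length l = 0} = {[]}"
      by auto
    moreover have "C \<noteq> {}"
      using C by auto
    ultimately show ?case
      by (simp add: card_of_singl_ordLeq)
  next
    case (Suc n)
    have "{l \<in> lists B. length l = Suc n} \<subseteq> (\<lambda>(b, l). b # l) ` (B \<times> {l \<in> lists B. length l = n})"
      by (force simp: length_Suc_conv)
    then have "|{l \<in> lists B. length l = Suc n}| \<le>o |B \<times> {l \<in> lists B. length l = n}|"
      by (rule surj_imp_ordLeq)
    also have "|B \<times> {l \<in> lists B. length l = n}| \<le>o |C|"
      using C BC Suc
      by (intro card_of_Times_ordLeq_infinite_Field) (simp_all add: card_of_card_order_on Field_card_of)
    finally show ?case .
  qed
  have "lists B = (\<Union>n. {l \<in> lists B. length l = n})"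
    by auto
  moreover have "|\<Union>n. {l \<in> lists B. length l = n}| \<le>o |C|"
    using C len by (intro card_of_UNION_ordLeq_infinite) (simp_all add: infinite_iff_card_of_nat)
  ultimately show ?thesis
    by simp
qed

text \<open>The recursion runs along a well-order of the type whose order type is the initial ordinal of its
  cardinality. Hence every proper initial segment is smaller than the type.\<close>

definition below :: "'a \<Rightarrow> 'a set"
  where "below \<gamma> = underS |UNIV :: 'a set| \<gamma>"

lemma wo_rel_UNIV: "wo_rel |UNIV :: 'a set|"
  by (simp add: wo_rel_def card_of_Well_order)

lemma wf_below: "wf {(\<delta>, \<gamma>). \<delta> \<in> below \<gamma>}"
proof -
  have "{(\<delta>, \<gamma>). \<delta> \<in> below \<gamma>} = |UNIV :: 'a set| - Id"
    by (auto simp: below_def underS_def)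
  then show ?thesis
    using wo_rel.WF[OF wo_rel_UNIV] by metis
qed

lemma below_trans:
  assumes "\<alpha> \<in> below \<beta>" "\<beta> \<in> below \<gamma>"
  shows "\<alpha> \<in> below \<gamma>"
proof -
  have le: "(\<alpha>, \<beta>) \<in> |UNIV|" "(\<beta>, \<gamma>) \<in> |UNIV|" and "\<alpha> \<noteq> \<beta>"
    using assms by (simp_all add: below_def underS_def)
  have "(\<alpha>, \<gamma>) \<in> |UNIV|"
    using wo_rel.TRANS[OF wo_rel_UNIV] le by (rule transD)
  moreover have "\<alpha> \<noteq> \<gamma>"
    using antisymD[OF wo_rel.ANTISYM[OF wo_rel_UNIV] le(1)] le(2) \<open>\<alpha> \<noteq> \<beta>\<close> by blast
  ultimately show ?thesis
    by (simp add: below_def underS_def)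
qed

lemma below_mono: "\<delta> \<in> below \<gamma> \<Longrightarrow> below \<delta> \<subseteq> below \<gamma>"
  by (rule subsetI) (rule below_trans)

lemma not_below_self: "\<gamma> \<notin> below \<gamma>"
  by (simp add: below_def underS_def)

lemma below_linear: "\<gamma> \<in> below \<delta> \<or> \<gamma> = \<delta> \<or> \<delta> \<in> below \<gamma>"
  using wo_rel.TOTALS[OF wo_rel_UNIV] by (auto simp: below_def underS_def Field_card_of)

lemma card_below: "|below (\<gamma> :: 'a)| <o |UNIV :: 'a set|"
  unfolding below_def by (rule card_of_underS[OF card_of_Card_order]) (simp add: Field_card_of)

lemma ex_above:
  assumes "infinite (UNIV :: 'a set)"
  shows "\<exists>\<delta>. (\<gamma> :: 'a) \<in> below \<delta>"
  using infinite_Card_order_limit[OF card_of_Card_order, of "UNIV :: 'a set" \<gamma>] assms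
  by (auto simp: below_def underS_def Field_card_of)

text \<open>Climbing \<open>n\<close> steps above \<open>\<beta>\<close> reaches a stage with at least \<open>n\<close> predecessors. At such a stage the
  length bound on words is large enough for the neighbourhoods of zero to be nonempty.\<close>

lemma ex_above_large:
  assumes inf: "infinite (UNIV :: 'a set)"
  shows "\<exists>\<gamma>. (\<beta> :: 'a) \<in> below \<gamma> \<and> (finite (below \<gamma>) \<longrightarrow> n \<le> card (below \<gamma>))"
proof (induction n)
  case 0
  show ?case
    using ex_above[OF inf] by simp
next
  case (Suc n)
  then obtain \<gamma> where \<gamma>: "\<beta> \<in> below \<gamma>" "finite (below \<gamma>) \<longrightarrow> n \<le> card (below \<gamma>)"
    by blast
  obtain \<delta> where \<delta>: "\<gamma> \<in> below \<delta>"
    using ex_above[OF inf] by blast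
  have "card (below \<gamma>) < card (below \<delta>)" if "finite (below \<delta>)"
    using below_mono[OF \<delta>] \<delta> not_below_self[of \<gamma>] that by (intro psubset_card_mono) blast+
  moreover have "finite (below \<gamma>)" if "finite (below \<delta>)"
    using that below_mono[OF \<delta>] finite_subset by blast
  ultimately show ?case
    using \<gamma> below_trans[OF \<gamma>(1) \<delta>] by (intro exI[of _ \<delta>]) auto
qed

text \<open>The size allowed for a set built at stage \<open>\<gamma>\<close>. Every tame set is smaller than an infinite type
  (\<open>tame_imp_small\<close>), and tameness survives the set operations of the recursion. Only for
  infinitely many predecessors does it survive the formation of all words, which is why words
  are kept short otherwise.\<close>

definition tame :: "'a \<Rightarrow> 'b set \<Rightarrow> bool"
  where "tame \<gamma> A \<longleftrightarrow> (if finite (below \<gamma>) then finite A else |A| \<le>o |below \<gamma>| )"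

lemma tame_below: "tame \<gamma> (below \<gamma>)"
  by (simp add: tame_def card_of_mono1)

lemma tame_image:
  assumes "tame \<gamma> A" "B \<subseteq> f ` A"
  shows "tame \<gamma> B"
proof (cases "finite (below \<gamma>)")
  case True
  then show ?thesis
    using assms finite_subset by (auto simp: tame_def)
next
  case False
  then show ?thesis
    using assms surj_imp_ordLeq[OF assms(2)] ordLeq_transitive by (auto simp: tame_def)
qed

lemma tame_mono:
  assumes "tame \<delta> A" "\<delta> \<in> below \<gamma>"
  shows "tame \<gamma> A"
proof (cases "finite (below \<delta>)")
  case fin: True
  show ?thesis
  proof (cases "finite (below \<gamma>)")
    case False
    then have "|A| \<le>o |below \<gamma>|"
      using assms(1) fin by (simp add: tame_def ordLess_imp_ordLeq finite_ordLess_infinite_set)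
    then show ?thesis
      using False by (simp add: tame_def)
  qed (use assms fin in \<open>simp add: tame_def\<close>)
next
  case False
  moreover have "infinite (below \<gamma>)"
    using False below_mono[OF assms(2)] finite_subset by blast
  moreover have "|below \<delta>| \<le>o |below \<gamma>|"
    using below_mono[OF assms(2)] by (rule card_of_mono1)
  ultimately show ?thesis
    using assms(1) ordLeq_transitive by (auto simp: tame_def)
qed

lemma tame_Times:
  assumes "tame \<gamma> A" "tame \<gamma> B"
  shows "tame \<gamma> (A \<times> B)"
  using assms card_of_Times_ordLeq_infinite_Field[of "|below \<gamma>|" A B]
  by (auto simp: tame_def card_of_card_order_on Field_card_of)

lemma tame_Un:
  assumes "tame \<gamma> A" "tame \<gamma> B"
  shows "tame \<gamma> (A \<union> B)"
  using assms card_of_Un_ordLeq_infinite_Field[of "|below \<gamma>|" A B]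
  by (auto simp: tame_def card_of_card_order_on Field_card_of)

lemma tame_UN:
  assumes "\<And>\<delta>. \<delta> \<in> below \<gamma> \<Longrightarrow> tame \<gamma> (A \<delta>)"
  shows "tame \<gamma> (\<Union>\<delta>\<in>below \<gamma>. A \<delta>)"
  using assms card_of_UNION_ordLeq_infinite[of "below \<gamma>" "below \<gamma>" A]
  by (auto simp: tame_def card_of_mono1)

lemma tame_imp_small:
  assumes "infinite (UNIV :: 'a set)" "tame (\<gamma> :: 'a) A"
  shows "|A| <o |UNIV :: 'a set|"
proof (cases "finite (below \<gamma>)")
  case True
  then show ?thesis
    using assms by (simp add: tame_def finite_ordLess_infinite_set)
next
  case False
  then show ?thesis
    using assms ordLeq_ordLess_trans[OF _ card_below[of \<gamma>]] by (simp add: tame_def)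
qed

section \<open>Values of short polynomials\<close>

text \<open>The nonconstant polynomials available at stage \<open>\<gamma>\<close> with coefficients in \<open>A\<close>. The bound on the
  length, written without division, is \<open>2^(n - j)\<close> when \<open>\<gamma>\<close> has \<open>n\<close> predecessors: raising \<open>j\<close> by one
  halves it, leaving room for one multiplication.\<close>

definition short_words :: "'a \<Rightarrow> nat \<Rightarrow> 'a set \<Rightarrow> 'a option list set"
  where "short_words \<gamma> j A = {w. None \<in> set w \<and> set w \<subseteq> insert None (Some ` A) \<and>
    (finite (below \<gamma>) \<longrightarrow> length w * 2 ^ j \<le> 2 ^ card (below \<gamma>))}"

lemma tame_short_words:
  assumes "tame \<gamma> A"
  shows "tame \<gamma> (short_words \<gamma> 0 A)"
proof (cases "finite (below \<gamma>)")
  case True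
  then have "finite {w. set w \<subseteq> insert None (Some ` A) \<and> length w \<le> 2 ^ card (below \<gamma>)}"
    using assms by (intro finite_lists_length_le) (simp add: tame_def)
  then have "finite (short_words \<gamma> 0 A)"
    by (rule rev_finite_subset) (use True in \<open>auto simp: short_words_def\<close>)
  then show ?thesis
    using True by (simp add: tame_def)
next
  case False
  have "tame \<gamma> {None :: 'a option}"
    using False by (simp add: tame_def ordLess_imp_ordLeq finite_ordLess_infinite_set)
  moreover have "tame \<gamma> (Some ` A)"
    using assms by (rule tame_image) (rule order_refl)
  ultimately have "tame \<gamma> (insert None (Some ` A))"
    using tame_Un by fastforce
  then have "|lists (insert None (Some ` A))| \<le>o |below \<gamma>|"
    using False by (intro card_of_lists_ordLeq_infinite) (simp_all add: tame_def)
  moreover have "short_words \<gamma> 0 A \<subseteq> lists (insert None (Some ` A))"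
    unfolding short_words_def by blast
  ultimately have "|short_words \<gamma> 0 A| \<le>o |below \<gamma>|"
    using card_of_mono1 ordLeq_transitive by blast
  then show ?thesis
    using False by (simp add: tame_def)
qed

definition word_values :: "'a::semigroup_mult \<Rightarrow> nat \<Rightarrow> 'a set \<Rightarrow> 'a \<Rightarrow> 'a set"
  where "word_values \<gamma> j A x = {y. \<exists>w\<in>short_words \<gamma> j A. eval_word w x = OElem y}"

lemma tame_word_values:
  assumes "tame \<gamma> A"
  shows "tame \<gamma> (word_values \<gamma> 0 A x)"
proof (rule tame_image[OF tame_short_words[OF assms]])
  show "word_values \<gamma> 0 A x \<subseteq> (\<lambda>w. inv OElem (eval_word w x)) ` short_words \<gamma> 0 A"
    by (force simp: word_values_def inj_def)
qed

lemma word_values_antimono: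
  assumes "i \<le> j"
  shows "word_values \<gamma> j A x \<subseteq> word_values \<gamma> i A x"
proof -
  have "l * 2 ^ i \<le> l * 2 ^ j" for l :: nat
    using assms by (simp add: power_increasing)
  then have "short_words \<gamma> j A \<subseteq> short_words \<gamma> i A"
    unfolding short_words_def using le_trans by blast
  then show ?thesis
    by (auto simp: word_values_def)
qed

text \<open>Concatenating two words at most doubles the length, which the step from \<open>Suc j\<close> to \<open>j\<close> pays for.\<close>

lemma word_values_mult:
  assumes "y \<in> word_values \<gamma> (Suc j) A x" "z \<in> word_values \<gamma> (Suc j) A x"
  shows "y * z \<in> word_values \<gamma> j A x"
proof -
  obtain v w where v: "v \<in> short_words \<gamma> (Suc j) A" "eval_word v x = OElem y"
    and w: "w \<in> short_words \<gamma> (Suc j) A" "eval_word w x = OElem z"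
    using assms by (auto simp: word_values_def)
  have "v @ w \<in> short_words \<gamma> j A"
    using v(1) w(1) by (auto simp: short_words_def algebra_simps)
  moreover have "eval_word (v @ w) x = OElem (y * z)"
    by (simp add: v w)
  ultimately show ?thesis
    unfolding word_values_def by blast
qed

text \<open>Words are nonempty because they contain the variable, so one more letter at most doubles the
  length as well.\<close>

lemma word_values_shift:
  assumes "y \<in> word_values \<gamma> (Suc j) A x" "a \<in> A"
  shows "a * y \<in> word_values \<gamma> j A x" "y * a \<in> word_values \<gamma> j A x"
proof -
  obtain w where w: "w \<in> short_words \<gamma> (Suc j) A" "eval_word w x = OElem y"
    using assms by (auto simp: word_values_def)
  have len: "Suc (length w) * 2 ^ j \<le> length w * 2 ^ Suc j"
    using w(1) by (cases w) (auto simp: short_words_def)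
  have "Some a # w \<in> short_words \<gamma> j A" "w @ [Some a] \<in> short_words \<gamma> j A"
    using w(1) assms(2) by (auto simp: short_words_def simp del: power_Suc mult_Suc intro: order_trans[OF len])
  moreover have "eval_word (Some a # w) x = OElem (a * y)" "eval_word (w @ [Some a]) x = OElem (y * a)"
    by (simp_all add: w one_one_ext_def)
  ultimately show "a * y \<in> word_values \<gamma> j A x" "y * a \<in> word_values \<gamma> j A x"
    unfolding word_values_def by blast+
qed

section \<open>The generic family and its topology\<close>

text \<open>Each equation between a short polynomial and an element of \<open>A\<close> has an algebraic solution set, and
  there are too few of these equations for their solutions to cover the semigroup. A point that
  solves none of them is the element sought.\<close>

lemma generic_element:
  fixes \<gamma> :: "'a::semigroup_mult"
  assumes inf: "infinite (UNIV :: 'a set)"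
    and no_cover: "\<nexists>C :: 'a set set. (\<forall>A\<in>C. algebraic_set A) \<and> |C| <o |UNIV :: 'a set| \<and> \<Union>C = UNIV"
    and "tame \<gamma> A"
  shows "\<exists>x. word_values \<gamma> 0 A x \<inter> A = {}"
proof -
  define C where "C = (\<lambda>(w, b). {x. eval_word w x = OElem b}) ` (short_words \<gamma> 0 A \<times> A)"
  have "tame \<gamma> C"
    unfolding C_def
    by (rule tame_image[OF tame_Times[OF tame_short_words[OF \<open>tame \<gamma> A\<close>] \<open>tame \<gamma> A\<close>] order_refl])
  moreover have "\<forall>B\<in>C. algebraic_set B"
    by (auto simp: C_def short_words_def intro: algebraic_set_word)
  ultimately have "\<Union>C \<noteq> UNIV"
    using no_cover tame_imp_small[OF inf] by blast
  then obtain x where "x \<notin> \<Union>C"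
    by blast
  then have "word_values \<gamma> 0 A x \<inter> A = {}"
    by (auto simp: C_def word_values_def)
  then show ?thesis ..
qed

text \<open>Iterating the previous choice: \<open>X \<gamma>\<close> collects the points below \<open>\<gamma>\<close>, so that in the end every
  point is avoided from some stage on, and all values formed at earlier stages, so that these
  become coefficients later.\<close>

lemma generic_family:
  assumes inf: "infinite (UNIV :: 'a::semigroup_mult set)"
    and no_cover: "\<nexists>C :: 'a set set. (\<forall>A\<in>C. algebraic_set A) \<and> |C| <o |UNIV :: 'a set| \<and> \<Union>C = UNIV"
  shows "\<exists>(x :: 'a \<Rightarrow> 'a) X. \<forall>\<gamma>.
    X \<gamma> = below \<gamma> \<union> (\<Union>\<delta>\<in>below \<gamma>. word_values \<delta> 0 (X \<delta>) (x \<delta>)) \<and>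
    word_values \<gamma> 0 (X \<gamma>) (x \<gamma>) \<inter> X \<gamma> = {}"
proof -
  \<comment> \<open>The recursion produces the sets of values \<open>Q \<gamma>\<close> rather than the points \<open>x \<gamma>\<close>: then \<open>X \<gamma>\<close> is
    an explicit function \<open>earlier Q \<gamma>\<close> of the previous results, and the tameness needed at stage \<open>\<gamma>\<close>
    can be carried along.\<close>
  define earlier where "earlier Q \<gamma> = below \<gamma> \<union> (\<Union>\<delta>\<in>below \<gamma>. Q \<delta>)" for Q :: "'a \<Rightarrow> 'a set" and \<gamma>
  define P where "P Q \<gamma> S \<longleftrightarrow> tame \<gamma> S \<and>
    (\<exists>x. S = word_values \<gamma> 0 (earlier Q \<gamma>) x \<and> S \<inter> earlier Q \<gamma> = {})" for Q :: "'a \<Rightarrow> 'a set" and \<gamma> S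
  have "\<exists>Q. \<forall>\<gamma>. P Q \<gamma> (Q \<gamma>)"
  proof (rule dependent_wf_choice[OF wf_below])
    fix Q Q' :: "'a \<Rightarrow> 'a set" and \<gamma> S
    assume "\<And>\<delta>. (\<delta>, \<gamma>) \<in> {(\<delta>, \<gamma>). \<delta> \<in> below \<gamma>} \<Longrightarrow> Q \<delta> = Q' \<delta>"
    then have "earlier Q \<gamma> = earlier Q' \<gamma>"
      by (simp add: earlier_def)
    then show "P Q \<gamma> S = P Q' \<gamma> S"
      by (simp add: P_def)
  next
    fix \<gamma> Q assume IH: "\<And>\<delta>. (\<delta>, \<gamma>) \<in> {(\<delta>, \<gamma>). \<delta> \<in> below \<gamma>} \<Longrightarrow> P Q \<delta> (Q \<delta>)"
    have tame: "tame \<gamma> (earlier Q \<gamma>)"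
      unfolding earlier_def
      by (intro tame_Un tame_below tame_UN) (rule tame_mono, use IH in \<open>auto simp: P_def\<close>)
    obtain x where "word_values \<gamma> 0 (earlier Q \<gamma>) x \<inter> earlier Q \<gamma> = {}"
      using generic_element[OF inf no_cover tame] by blast
    then show "\<exists>S. P Q \<gamma> S"
      using tame_word_values[OF tame] unfolding P_def by blast
  qed
  then obtain Q x where Q: "\<And>\<gamma>. Q \<gamma> = word_values \<gamma> 0 (earlier Q \<gamma>) (x \<gamma>)"
    and avoid: "\<And>\<gamma>. Q \<gamma> \<inter> earlier Q \<gamma> = {}"
    unfolding P_def by metis
  show ?thesis
  proof (intro exI[of _ x] exI[of _ "earlier Q"] allI conjI)
    fix \<gamma>
    show "earlier Q \<gamma> = below \<gamma> \<union> (\<Union>\<delta>\<in>below \<gamma>. word_values \<delta> 0 (earlier Q \<delta>) (x \<delta>))"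
      unfolding Q[symmetric] by (rule earlier_def)
    show "word_values \<gamma> 0 (earlier Q \<gamma>) (x \<gamma>) \<inter> earlier Q \<gamma> = {}"
      unfolding Q[symmetric] by (rule avoid)
  qed
qed

text \<open>The neighbourhoods of zero are indexed by a stage \<open>\<beta>\<close> and a number \<open>j\<close> of reserved doublings of
  the word length. Two values from different stages multiply to a value of the later stage, since
  the earlier one has become a coefficient; two values from the same stage are concatenated.\<close>

lemma generic_family_imp_not_zero_closed:
  fixes x :: "'a::semigroup_mult \<Rightarrow> 'a"
  assumes inf: "infinite (UNIV :: 'a set)"
    and X: "\<And>\<gamma>. X \<gamma> = below \<gamma> \<union> (\<Union>\<delta>\<in>below \<gamma>. word_values \<delta> 0 (X \<delta>) (x \<delta>))"
    and avoid: "\<And>\<gamma>. word_values \<gamma> 0 (X \<gamma>) (x \<gamma>) \<inter> X \<gamma> = {}"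
  shows "\<not> zero_closed TYPE('a)"
proof -
  define W where "W \<gamma> j = word_values \<gamma> j (X \<gamma>) (x \<gamma>)" for \<gamma> j
  define V where "V = (\<lambda>(\<beta>, j). \<Union>\<gamma>\<in>{\<gamma>. \<beta> \<in> below \<gamma>}. W \<gamma> j)"
  have V_iff: "y \<in> V (\<beta>, j) \<longleftrightarrow> (\<exists>\<gamma>. \<beta> \<in> below \<gamma> \<and> y \<in> W \<gamma> j)" for y \<beta> j
    by (auto simp: V_def)
  have W_antimono: "W \<gamma> j \<subseteq> W \<gamma> i" if "i \<le> j" for \<gamma> i j
    unfolding W_def by (rule word_values_antimono[OF that])
  have W_later: "W \<gamma> j \<subseteq> X \<delta>" if "\<gamma> \<in> below \<delta>" for \<gamma> \<delta> j
    using X[of \<delta>] that W_antimono[of 0 j \<gamma>] by (auto simp: W_def)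
  have V_antimono: "V (\<gamma>, m) \<subseteq> V (\<beta>, j)" if "\<beta> \<in> below \<gamma>" "j \<le> m" for \<beta> \<gamma> :: 'a and j m
    using W_antimono[OF that(2)] below_trans[OF that(1)] by (fastforce simp: V_iff)
  have upper: "\<exists>\<gamma>. \<alpha> \<in> below \<gamma> \<and> \<beta> \<in> below \<gamma>" for \<alpha> \<beta> :: 'a
    using ex_above[OF inf] below_linear below_trans by metis
  show ?thesis
  proof (rule not_zero_closedI[of V])
    show "V i \<noteq> {}" for i
    proof -
      obtain \<beta> j where i: "i = (\<beta>, j)"
        by (cases i)
      obtain \<gamma> where \<gamma>: "\<beta> \<in> below \<gamma>" "finite (below \<gamma>) \<longrightarrow> j \<le> card (below \<gamma>)"
        using ex_above_large[OF inf] by blast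
      then have "[None] \<in> short_words \<gamma> j (X \<gamma>)"
        by (simp add: short_words_def power_increasing)
      moreover have "eval_word [None] (x \<gamma>) = OElem (x \<gamma>)"
        by (simp add: one_one_ext_def)
      ultimately have "x \<gamma> \<in> W \<gamma> j"
        unfolding W_def word_values_def by blast
      then show ?thesis
        using \<gamma>(1) V_iff i by blast
    qed
  next
    fix i j :: "'a \<times> nat"
    obtain \<alpha> m \<beta> n where ij: "i = (\<alpha>, m)" "j = (\<beta>, n)"
      by (cases i; cases j)
    obtain \<gamma> where "\<alpha> \<in> below \<gamma>" "\<beta> \<in> below \<gamma>"
      using upper by blast
    then have "V (\<gamma>, max m n) \<subseteq> V i \<inter> V j"
      by (simp add: ij V_antimono)
    then show "\<exists>k. V k \<subseteq> V i \<inter> V j" ..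
  next
    fix i :: "'a \<times> nat"
    obtain \<beta> j where i: "i = (\<beta>, j)"
      by (cases i)
    have "y * z \<in> V i" if yz: "y \<in> V (\<beta>, Suc j)" "z \<in> V (\<beta>, Suc j)" for y z
    proof -
      obtain \<gamma> \<delta> where \<gamma>: "\<beta> \<in> below \<gamma>" "y \<in> W \<gamma> (Suc j)" and \<delta>: "\<beta> \<in> below \<delta>" "z \<in> W \<delta> (Suc j)"
        using yz by (auto simp: V_iff)
      consider "\<gamma> \<in> below \<delta>" | "\<gamma> = \<delta>" | "\<delta> \<in> below \<gamma>"
        using below_linear[of \<gamma> \<delta>] by blast
      then show ?thesis
      proof cases
        case 1
        then have "y * z \<in> W \<delta> j"
          using W_later \<gamma>(2) \<delta>(2) unfolding W_def by (blast intro: word_values_shift)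
        then show ?thesis
          using \<delta>(1) V_iff i by blast
      next
        case 2
        then have "y * z \<in> W \<gamma> j"
          using \<gamma>(2) \<delta>(2) unfolding W_def by (blast intro: word_values_mult)
        then show ?thesis
          using \<gamma>(1) V_iff i by blast
      next
        case 3
        then have "y * z \<in> W \<gamma> j"
          using W_later \<gamma>(2) \<delta>(2) unfolding W_def by (blast intro: word_values_shift)
        then show ?thesis
          using \<gamma>(1) V_iff i by blast
      qed
    qed
    then show "\<exists>j. \<forall>y\<in>V j. \<forall>z\<in>V j. y * z \<in> V i"
      by blast
  next
    fix i :: "'a \<times> nat" and a :: 'a
    obtain \<beta> j where i: "i = (\<beta>, j)"
      by (cases i)
    obtain \<alpha> where \<alpha>: "\<beta> \<in> below \<alpha>" "a \<in> below \<alpha>"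
      using upper by blast
    have "a * y \<in> V i \<and> y * a \<in> V i" if y: "y \<in> V (\<alpha>, Suc j)" for y
    proof -
      obtain \<gamma> where \<gamma>: "\<alpha> \<in> below \<gamma>" "y \<in> W \<gamma> (Suc j)"
        using y by (auto simp: V_iff)
      have "a \<in> X \<gamma>"
        using X[of \<gamma>] below_trans[OF \<alpha>(2) \<gamma>(1)] by blast
      then have "a * y \<in> W \<gamma> j" "y * a \<in> W \<gamma> j"
        using \<gamma>(2) unfolding W_def by (blast intro: word_values_shift)+
      then show ?thesis
        using below_trans[OF \<alpha>(1) \<gamma>(1)] V_iff i by blast
    qed
    then show "\<exists>j. \<forall>y\<in>V j. a * y \<in> V i \<and> y * a \<in> V i"
      by blast
  next
    fix b :: 'a
    \<comment> \<open>At all stages above \<open>b\<close> the point \<open>b\<close> is among those to be avoided.\<close>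
    have "b \<notin> V (b, 0)"
      using X avoid unfolding V_iff W_def by blast
    then show "\<exists>i. b \<notin> V i" ..
  qed
qed

section \<open>The polyboundedness number of a zero-closed semigroup\<close>

text \<open>For finite semigroups the bound \<open>2\<close> in the maximum is the relevant one, for infinite semigroups the
  cardinality is.\<close>

theorem theorem1:
  assumes "zero_closed TYPE('a::semigroup_mult)"
  shows "polyboundedness_number TYPE('a) <o card_max ctwo |UNIV :: 'a set|"
proof -
  have "\<Union>{A :: 'a set. algebraic_set A} = UNIV"
    using algebraic_set_singleton by blast
  then have le: "polyboundedness_number TYPE('a) \<le>o |C|"
    if "\<forall>A\<in>C. algebraic_set A" "\<Union>C = UNIV" for C :: "'a set set"
    unfolding polyboundedness_number_def
    by (rule covering_number_least(2)) (use that in auto)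
  have ctwo_le: "ctwo \<le>o card_max ctwo |UNIV :: 'a set|"
    and UNIV_le: "|UNIV :: 'a set| \<le>o card_max ctwo |UNIV :: 'a set|"
    using ordLeq_total[of ctwo "|UNIV :: 'a set|"] card_max_ordIso[of ctwo "|UNIV :: 'a set|"]
      Card_order_ctwo card_of_Card_order
    by (meson card_of_Well_order card_order_on_well_order_on ordIso_symmetric ordLeq_ordIso_trans
        ordIso_iff_ordLeq)+
  show ?thesis
  proof (cases "finite (UNIV :: 'a set)")
    case True
    then obtain w e where w: "None \<in> set w" "\<And>x::'a. eval_word w x = OElem e"
      using finite_semigroup_constant_word by metis
    have "algebraic_set (UNIV :: 'a set)"
      using algebraic_set_word[OF w(1), of e] w(2) by simp
    then have "polyboundedness_number TYPE('a) \<le>o |{UNIV :: 'a set}|"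
      by (intro le) simp_all
    also have "|{UNIV :: 'a set}| <o ctwo"
      unfolding ctwo_def by (rule iffD1[OF card_of_ordLess2], auto simp: UNIV_bool)
    finally show ?thesis
      using ctwo_le ordLess_ordLeq_trans by blast
  next
    case False
    have "\<exists>C :: 'a set set. (\<forall>A\<in>C. algebraic_set A) \<and> |C| <o |UNIV :: 'a set| \<and> \<Union>C = UNIV"
    proof (rule ccontr)
      assume "\<not> ?thesis"
      from generic_family[OF False this] show False
      proof (elim exE)
        fix x :: "'a \<Rightarrow> 'a" and X
        assume family: "\<forall>\<gamma>. X \<gamma> = below \<gamma> \<union> (\<Union>\<delta>\<in>below \<gamma>. word_values \<delta> 0 (X \<delta>) (x \<delta>)) \<and>
          word_values \<gamma> 0 (X \<gamma>) (x \<gamma>) \<inter> X \<gamma> = {}"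
        have "\<not> zero_closed TYPE('a)"
          by (rule generic_family_imp_not_zero_closed[OF False
                conjunct1[OF spec[OF family]] conjunct2[OF spec[OF family]]])
        with assms show False
          by contradiction
      qed
    qed
    then have "polyboundedness_number TYPE('a) <o |UNIV :: 'a set|"
      using le ordLeq_ordLess_trans by blast
    then show ?thesis
      using UNIV_le ordLess_ordLeq_trans by blast
  qed
qed

end
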